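(* Let $\mathcal A\subseteq\mathbb R^s$ be a Borel set with $\lambda^s(\mathcal A)>0$, let $h\colon\mathbb R^s\to\mathbb R^m$ with $s\le m$ be real analytic with $s$-dimensional Jacobian $Jh$ not identically zero, and let $f\colon\mathbb R^m\to\mathbb R^n$ be real analytic. If $f$ is one-to-one on $h(\mathcal A)$, then $n\ge s$.
   Context: For differentiable $h\colon\mathbb R^s\to\mathbb R^m$ with $m\ge s$ and differential $Dh(\mathbf v)\in\mathbb R^{m\times s}$, $Jh(\mathbf v)=\sqrt{\det(Dh(\mathbf v)^TDh(\mathbf v))}$. $\lambda^s$ is Lebesgue measure on $\mathbb R^s$. *)

theory Defs
  imports "HOL-Analysis.Analysis"
begin

definition real_analytic_at :: "(real^'s \<Rightarrow> real^'m) \<Rightarrow> real^'s \<Rightarrow> bool" where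
  "real_analytic_at f x \<longleftrightarrow>
     (\<exists>r>0. \<exists>c :: ('s \<Rightarrow> nat) \<Rightarrow> real^'m.
        \<forall>y\<in>ball x r.
          ((\<lambda>\<alpha>. (\<Prod>i\<in>UNIV. (y$i - x$i) ^ (\<alpha> i)) *\<^sub>R c \<alpha>) has_sum f y) UNIV)"

definition real_analytic :: "(real^'s \<Rightarrow> real^'m) \<Rightarrow> bool" where
  "real_analytic f \<longleftrightarrow> (\<forall>x. real_analytic_at f x)"

definition sJac :: "(real^'s \<Rightarrow> real^'m) \<Rightarrow> real^'s \<Rightarrow> real" where
  "sJac h v = sqrt (det (transpose (jacobian h (at v)) ** jacobian h (at v)))"

end

theory Submission
  imports Defs "HOL-Complex_Analysis.Complex_Analysis"
begin

text \<open>
  Suppose \<open>n < s\<close> and put \<open>g = f \<circ> h\<close>. Where \<open>Jh \<noteq> 0\<close>, the map \<open>h\<close> is locally injective, hence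
  \<open>g\<close> is injective on small pieces of \<open>A\<close>; it suffices that these pieces are null.
  Among the maps \<open>\<Phi>\<close> of \<open>\<real>\<^sup>s\<close> to itself obtained from the identity by replacing the
  coordinates in a set \<open>J\<close> with components of \<open>g\<close>, take one with \<open>J\<close> maximal such that
  \<open>det D\<Phi>\<close> is not identically zero. Then \<open>J\<close> misses some coordinate \<open>i\<close> because \<open>n < s\<close>, and
  maximality says that, wherever \<open>\<Phi>\<close> is a local diffeomorphism, \<open>g \<circ> \<Phi>\<^sup>-\<^sup>1\<close> does not
  depend on the \<open>i\<close>-th coordinate. So a set on which \<open>g\<close> is injective is carried by \<open>\<Phi>\<close> to a set meeting
  each line parallel to the \<open>i\<close>-th axis at most once, which is null by Fubini.

  The exceptional sets are zero sets of polynomials in partial derivatives of \<open>f\<close> (along \<open>h\<close>)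
  and of \<open>h\<close>. Such a function is analytic along every line, so it has only countably many zeros
  on each line through a point where it does not vanish, and Fubini over dilations from that point
  shows that its zero set is null.
\<close>

section \<open>Functions analytic along lines\<close>

text \<open>Analyticity at a real point is encoded by a holomorphic extension to a complex disc, so
  that isolation of zeros and stability under uniform limits come from complex analysis.\<close>

definition hol_ext_at :: "(real \<Rightarrow> real) \<Rightarrow> real \<Rightarrow> bool" where
  "hol_ext_at \<gamma> t \<longleftrightarrow>
     (\<exists>r>0. \<exists>F. F holomorphic_on ball (of_real t) r \<and>
        (\<forall>u. \<bar>u - t\<bar> < r \<longrightarrow> F (of_real u) = of_real (\<gamma> u)))"

section \<open>Algebra and zeros of functions with local holomorphic extensions\<close>

lemma hol_ext_at_const: "hol_ext_at (\<lambda>_. c) t"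
  unfolding hol_ext_at_def by (intro exI[of _ 1] conjI exI[of _ "\<lambda>_. of_real c"]) auto

lemma hol_ext_at_affine: "hol_ext_at (\<lambda>u. a + u * b) t"
  unfolding hol_ext_at_def
  by (intro exI[of _ 1] conjI exI[of _ "\<lambda>z. of_real a + z * of_real b"])
     (auto intro!: holomorphic_intros)

lemma hol_ext_at_add:
  assumes "hol_ext_at \<gamma> t" "hol_ext_at \<delta> t"
  shows "hol_ext_at (\<lambda>u. \<gamma> u + \<delta> u) t"
proof -
  obtain r F where F: "r > 0" "F holomorphic_on ball (of_real t) r"
    "\<And>u. \<bar>u - t\<bar> < r \<Longrightarrow> F (of_real u) = of_real (\<gamma> u)" using assms(1) unfolding hol_ext_at_def by blast
  obtain s G where G: "s > 0" "G holomorphic_on ball (of_real t) s"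
    "\<And>u. \<bar>u - t\<bar> < s \<Longrightarrow> G (of_real u) = of_real (\<delta> u)" using assms(2) unfolding hol_ext_at_def by blast
  have "F holomorphic_on ball (of_real t) (min r s)" "G holomorphic_on ball (of_real t) (min r s)"
    using F(2) G(2) by (auto elim!: holomorphic_on_subset)
  then show ?thesis unfolding hol_ext_at_def
    by (intro exI[of _ "min r s"] conjI exI[of _ "\<lambda>z. F z + G z"])
       (use F G in \<open>auto intro!: holomorphic_intros\<close>)
qed

lemma hol_ext_at_mult:
  assumes "hol_ext_at \<gamma> t" "hol_ext_at \<delta> t"
  shows "hol_ext_at (\<lambda>u. \<gamma> u * \<delta> u) t"
proof -
  obtain r F where F: "r > 0" "F holomorphic_on ball (of_real t) r"
    "\<And>u. \<bar>u - t\<bar> < r \<Longrightarrow> F (of_real u) = of_real (\<gamma> u)" using assms(1) unfolding hol_ext_at_def by blast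
  obtain s G where G: "s > 0" "G holomorphic_on ball (of_real t) s"
    "\<And>u. \<bar>u - t\<bar> < s \<Longrightarrow> G (of_real u) = of_real (\<delta> u)" using assms(2) unfolding hol_ext_at_def by blast
  have "F holomorphic_on ball (of_real t) (min r s)" "G holomorphic_on ball (of_real t) (min r s)"
    using F(2) G(2) by (auto elim!: holomorphic_on_subset)
  then show ?thesis unfolding hol_ext_at_def
    by (intro exI[of _ "min r s"] conjI exI[of _ "\<lambda>z. F z * G z"])
       (use F G in \<open>auto intro!: holomorphic_intros\<close>)
qed

text \<open>A zero of the extension \<open>F\<close> at the centre is isolated unless
  \<open>F\<close> vanishes on the whole disc; if \<open>F\<close> is nonzero at the centre,
  continuity suffices.\<close>

lemma hol_ext_at_zero_dichotomy:
  assumes "hol_ext_at \<gamma> t"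
  shows "(\<forall>\<^sub>F u in nhds t. \<gamma> u = 0) \<or> (\<forall>\<^sub>F u in at t. \<gamma> u \<noteq> 0)"
proof -
  obtain r F where F: "r > 0" "F holomorphic_on ball (of_real t) r"
    "\<And>u. \<bar>u - t\<bar> < r \<Longrightarrow> F (of_real u) = of_real (\<gamma> u)" using assms(1) unfolding hol_ext_at_def by blast
  consider "\<forall>z\<in>ball (of_real t) r. F z = 0" | "F (of_real t) \<noteq> 0"
    | \<beta> where "F (of_real t) = 0" "\<beta> \<in> ball (of_real t) r" "F \<beta> \<noteq> 0" by blast
  then show ?thesis
  proof cases
    case 1
    have "\<forall>u. dist u t < r \<longrightarrow> \<gamma> u = 0"
    proof (intro allI impI)
      fix u assume u: "dist u t < r"
      then have "F (of_real u) = 0" using 1 by (simp add: dist_of_real dist_commute)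
      then show "\<gamma> u = 0" using F(3)[of u] u by (simp add: dist_real_def)
    qed
    then show ?thesis using F(1) unfolding eventually_nhds_metric by blast
  next
    case 2
    have "continuous_on (ball (of_real t) r) F" using F(2) holomorphic_on_imp_continuous_on by blast
    then have "isCont F (of_real t)" using F(1) by (simp add: continuous_on_eq_continuous_at)
    then obtain d where d: "d > 0" "\<And>z. dist z (of_real t) < d \<Longrightarrow> F z \<noteq> 0"
      using continuous_at_avoid[of "of_real t" F 0] 2 by (auto simp: dist_commute)
    have "\<gamma> u \<noteq> 0" if "dist u t < min r d" for u
      using d(2)[of "of_real u"] F(3)[of u] that by (auto simp: dist_of_real dist_real_def)
    then have "\<forall>\<^sub>F u in at t. \<gamma> u \<noteq> 0" using F(1) d(1)
      unfolding eventually_at by (intro exI[of _ "min r d"]) auto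
    then show ?thesis by blast
  next
    case 3
    obtain d where d: "0 < d"
      "\<And>z. z \<in> ball (of_real t) d - {of_real t} \<Longrightarrow> F z \<noteq> 0"
      by (rule isolated_zeros[OF F(2) open_ball connected_ball _ 3]) (use F(1) in auto)
    have "\<gamma> u \<noteq> 0" if "dist u t < min r d" "u \<noteq> t" for u
      using d(2)[of "of_real u"] F(3)[of u] that by (auto simp: dist_of_real dist_real_def abs_minus_commute)
    then have "\<forall>\<^sub>F u in at t. \<gamma> u \<noteq> 0" using F(1) d(1)
      unfolding eventually_at by (intro exI[of _ "min r d"]) auto
    then show ?thesis by blast
  qed
qed

text \<open>The set \<open>W\<close> of points near which \<gamma> vanishes is clopen and misses
  \<open>t0\<close>, hence is empty. The zeros are then sparse in the line, so countable.\<close>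

lemma hol_ext_countable_zeros:
  assumes hol: "\<And>t. hol_ext_at \<gamma> t" and nz: "\<gamma> t0 \<noteq> 0"
  shows "countable {t. \<gamma> t = 0}"
proof -
  define W where "W = {t. \<forall>\<^sub>F u in nhds t. \<gamma> u = 0}"
  have "open W"
    unfolding W_def open_subopen[of "Collect _"]
    by (auto simp: eventually_nhds)
  moreover have "open (- W)"
    unfolding open_subopen[of "- W"]
  proof (intro ballI)
    fix t assume "t \<in> - W"
    then have "\<forall>\<^sub>F u in at t. \<gamma> u \<noteq> 0" using hol_ext_at_zero_dichotomy[OF hol] by (auto simp: W_def)
    then obtain S where S: "open S" "t \<in> S" "\<And>u. u \<in> S \<Longrightarrow> u \<noteq> t \<Longrightarrow> \<gamma> u \<noteq> 0"
      unfolding eventually_at_topological by auto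
    have "S - {t} \<subseteq> - W"
      using S(3) by (auto simp: W_def dest!: eventually_nhds_x_imp_x)
    then show "\<exists>T. open T \<and> t \<in> T \<and> T \<subseteq> - W" using S \<open>t \<in> - W\<close> by (intro exI[of _ S]) auto
  qed
  moreover have "t0 \<notin> W" using nz by (auto simp: W_def dest!: eventually_nhds_x_imp_x)
  ultimately have "W = {}"
    using clopen[of W] by (auto simp: closed_def)
  then have "\<forall>\<^sub>F u in at t. \<gamma> u \<noteq> 0" for t
    using hol_ext_at_zero_dichotomy[OF hol, of t] by (auto simp: W_def)
  then have "{t. \<gamma> t = 0} sparse_in UNIV"
    by (subst sparse_in_eventually_iff) auto
  from sparse_imp_countable[OF open_UNIV this] show ?thesis by simp
qed

text \<open>Tonelli on the set of pairs \<open>(t, x)\<close>: its sections in \<open>t\<close> are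
  countable, hence null, so almost every section in \<open>x\<close> is null. Positivity of
  \<open>t\<close> is there for dilations, which must be invertible.\<close>

lemma negligible_preimage_if_countable_sections:
  fixes B :: "'a::euclidean_space set" and T :: "real \<Rightarrow> 'a \<Rightarrow> 'a"
  assumes B: "B \<in> sets borel" and T: "continuous_on UNIV (\<lambda>(t, x). T t x)"
    and cnt: "\<And>x. countable {t. T t x \<in> B}"
  obtains t where "t > 0" "negligible {x. T t x \<in> B}"
proof -
  define X where "X = {(t, x). T t x \<in> B}"
  have "(\<lambda>(t, x). T t x) \<in> borel_measurable borel"
    using T by (rule borel_measurable_continuous_onI)
  then have "(\<lambda>(t, x). T t x) -` B \<inter> space borel \<in> sets borel"
    using B by (rule measurable_sets)
  also have "(\<lambda>(t, x). T t x) -` B \<inter> space borel = X" by (auto simp: X_def)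
  finally have X: "X \<in> sets (lborel \<Otimes>\<^sub>M lborel)" unfolding lborel_prod by simp
  have "emeasure (lborel \<Otimes>\<^sub>M lborel) X = (\<integral>\<^sup>+x. emeasure lborel ((\<lambda>t. (t, x)) -` X) \<partial>lborel)"
    by (rule lborel_pair.emeasure_pair_measure_alt2[OF X])
  also have "\<dots> = (\<integral>\<^sup>+x. 0 \<partial>(lborel :: 'a measure))"
    by (intro nn_integral_cong) (simp add: X_def vimage_def cnt emeasure_lborel_countable)
  finally have "emeasure (lborel \<Otimes>\<^sub>M lborel) X = 0" by simp
  then have "X \<in> null_sets (lborel \<Otimes>\<^sub>M lborel)" using X by auto
  then have "AE z in lborel \<Otimes>\<^sub>M lborel. z \<notin> X" by (rule AE_not_in)
  then have ae: "AE t in lborel. AE x in lborel. (t, x) \<notin> X" by (rule lborel_pair.AE_pair)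
  \<comment> \<open>The interval from 0 to 1 is not null, so what holds for almost every
    \<open>t\<close> holds for some positive one.\<close>
  have "\<exists>t>0. AE x in lborel. (t, x) \<notin> X"
  proof (rule ccontr)
    assume "\<not> ?thesis"
    with ae have "AE t in lborel. t \<notin> {0<..<1::real}"
      by (auto elim!: eventually_mono)
    then have "{0<..<1::real} \<in> null_sets lborel" by (subst AE_iff_null_sets) auto
    then show False by (auto simp: null_sets_def)
  qed
  then obtain t where t: "t > 0" "AE x in lborel. T t x \<notin> B" by (auto simp: X_def)
  then obtain N where N: "\<And>x. x \<in> space lborel - N \<Longrightarrow> T t x \<notin> B" "N \<in> null_sets lborel"
    using AE_E3 by blast
  have "{x. T t x \<in> B} \<subseteq> N" using N(1) by auto
  then have "negligible {x. T t x \<in> B}"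
    using N(2) unfolding negligible_iff_null_sets null_sets_completion_iff2 by blast
  with t show ?thesis using that by blast
qed


text \<open>For a suitable \<open>t > 0\<close>, the dilation by \<open>t\<close> about
  \<open>p\<close> carries a null set onto \<open>B\<close>. The case \<open>x = 0\<close> of
  \<open>cnt\<close> keeps \<open>p\<close> itself outside \<open>B\<close>.\<close>

lemma negligible_if_countable_on_rays:
  fixes B :: "'a::euclidean_space set"
  assumes B: "B \<in> sets borel" and cnt: "\<And>x. countable {t. p + t *\<^sub>R x \<in> B}"
  shows "negligible B"
proof -
  have T: "continuous_on UNIV (\<lambda>(t, x). p + t *\<^sub>R (x::'a))"
    by (auto simp: case_prod_unfold intro!: continuous_intros)
  obtain t :: real where t: "t > 0" "negligible {x. p + t *\<^sub>R x \<in> B}"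
    using negligible_preimage_if_countable_sections[OF B T cnt] by blast
  have "negligible ((\<lambda>x. p + t *\<^sub>R x) ` {x. p + t *\<^sub>R x \<in> B})"
    by (intro negligible_differentiable_image_negligible t order_refl) (auto intro!: derivative_intros)
  moreover have "B \<subseteq> (\<lambda>x. p + t *\<^sub>R x) ` {x. p + t *\<^sub>R x \<in> B}"
  proof
    fix y assume "y \<in> B"
    then show "y \<in> (\<lambda>x. p + t *\<^sub>R x) ` {x. p + t *\<^sub>R x \<in> B}"
      using t(1) by (intro image_eqI[of _ _ "(y - p) /\<^sub>R t"]) auto
  qed
  ultimately show ?thesis by (rule negligible_subset)
qed

lemma negligible_if_countable_on_parallels:
  fixes B :: "'a::euclidean_space set"
  assumes B: "B \<in> sets borel" and cnt: "\<And>x. countable {t. x + t *\<^sub>R e \<in> B}"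
  shows "negligible B"
proof -
  have T: "continuous_on UNIV (\<lambda>(t, x). (x::'a) + t *\<^sub>R e)"
    by (auto simp: case_prod_unfold intro!: continuous_intros)
  obtain t :: real where t: "negligible {x. x + t *\<^sub>R e \<in> B}"
    using negligible_preimage_if_countable_sections[OF B T cnt] by blast
  have "negligible ((+) (t *\<^sub>R e) ` {x. x + t *\<^sub>R e \<in> B})"
    by (rule negligible_translation[OF t])
  moreover have "B \<subseteq> (+) (t *\<^sub>R e) ` {x. x + t *\<^sub>R e \<in> B}"
  proof
    fix y assume "y \<in> B"
    then show "y \<in> (+) (t *\<^sub>R e) ` {x. x + t *\<^sub>R e \<in> B}"
      by (intro image_eqI[of _ _ "y - t *\<^sub>R e"]) auto
  qed
  ultimately show ?thesis by (rule negligible_subset)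
qed

text \<open>Weaker than joint analyticity, yet enough for null zero sets and stable under the
  operations that build determinants. Continuity makes zero sets closed, hence Borel.\<close>

definition line_analytic :: "('a::euclidean_space \<Rightarrow> real) \<Rightarrow> bool" where
  "line_analytic \<psi> \<longleftrightarrow>
     continuous_on UNIV \<psi> \<and> (\<forall>p v t. hol_ext_at (\<lambda>u. \<psi> (p + u *\<^sub>R v)) t)"

text \<open>On every line through \<open>p\<close> the restriction of \<psi> is nonzero at parameter
  0, so it has only countably many zeros there.\<close>

lemma line_analytic_negligible_zeros:
  fixes \<psi> :: "'a::euclidean_space \<Rightarrow> real"
  assumes \<psi>: "line_analytic \<psi>" and nz: "\<psi> p \<noteq> 0"
  shows "negligible {x. \<psi> x = 0}"
proof (rule negligible_if_countable_on_rays[of _ p])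
  have "closed (\<psi> -` {0})"
    using \<psi> by (intro closed_vimage) (auto simp: line_analytic_def)
  then show "{x. \<psi> x = 0} \<in> sets borel" by (simp add: vimage_def)
  show "countable {t. p + t *\<^sub>R x \<in> {x. \<psi> x = 0}}" for x
    using hol_ext_countable_zeros[of "\<lambda>u. \<psi> (p + u *\<^sub>R x)" 0] \<psi> nz
    by (auto simp: line_analytic_def)
qed

section \<open>Closure properties of line-analytic functions\<close>

lemma line_analytic_const: "line_analytic (\<lambda>_. c)"
  by (auto simp: line_analytic_def hol_ext_at_const)

lemma line_analytic_add:
  "line_analytic \<phi> \<Longrightarrow> line_analytic \<psi> \<Longrightarrow> line_analytic (\<lambda>x. \<phi> x + \<psi> x)"
  unfolding line_analytic_def by (intro conjI allI continuous_on_add hol_ext_at_add) auto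

lemma line_analytic_mult:
  "line_analytic \<phi> \<Longrightarrow> line_analytic \<psi> \<Longrightarrow> line_analytic (\<lambda>x. \<phi> x * \<psi> x)"
  unfolding line_analytic_def by (intro conjI allI continuous_on_mult hol_ext_at_mult) auto

lemma line_analytic_sum:
  "(\<And>i. i \<in> I \<Longrightarrow> line_analytic (\<phi> i)) \<Longrightarrow> line_analytic (\<lambda>x. \<Sum>i\<in>I. \<phi> i x)"
  by (induction I rule: infinite_finite_induct) (auto intro: line_analytic_const line_analytic_add)

lemma line_analytic_prod:
  "(\<And>i. i \<in> I \<Longrightarrow> line_analytic (\<phi> i)) \<Longrightarrow> line_analytic (\<lambda>x. \<Prod>i\<in>I. \<phi> i x)"
  by (induction I rule: infinite_finite_induct) (auto intro: line_analytic_const line_analytic_mult)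

lemma line_analytic_det:
  fixes M :: "'a::euclidean_space \<Rightarrow> real^'n^'n"
  assumes "\<And>i j. line_analytic (\<lambda>x. M x $ i $ j)"
  shows "line_analytic (\<lambda>x. det (M x))"
  unfolding det_def
  by (intro line_analytic_sum line_analytic_mult line_analytic_prod line_analytic_const assms)

lemma line_analytic_matrix_mult:
  fixes M :: "'a::euclidean_space \<Rightarrow> real^'n^'m" and N :: "'a \<Rightarrow> real^'k^'n"
  assumes "\<And>i j. line_analytic (\<lambda>x. M x $ i $ j)" "\<And>i j. line_analytic (\<lambda>x. N x $ i $ j)"
  shows "line_analytic (\<lambda>x. (M x ** N x) $ i $ j)"
  by (simp add: matrix_matrix_mult_def line_analytic_sum line_analytic_mult assms)

section \<open>Power series and their derivatives\<close>

text \<open>The exponents \<open>\<beta> k\<close> need not be distinct, so the termwise derivative of such a series is again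
  one of the same kind, without reindexing.\<close>

definition ps_at :: "(real^'s \<Rightarrow> real) \<Rightarrow> real^'s \<Rightarrow> bool" where
  "ps_at \<phi> x \<longleftrightarrow>
     (\<exists>\<rho>>0. \<exists>(a :: nat \<Rightarrow> real) (\<beta> :: nat \<Rightarrow> 's \<Rightarrow> nat).
        summable (\<lambda>k. \<bar>a k\<bar> * \<rho> ^ (\<Sum>i\<in>UNIV. \<beta> k i)) \<and>
        (\<forall>y. (\<forall>i. \<bar>y$i - x$i\<bar> \<le> \<rho>) \<longrightarrow> \<phi> y = (\<Sum>k. a k * (\<Prod>i\<in>UNIV. (y$i - x$i) ^ \<beta> k i))))"

lemma norm_monomial_le:
  fixes w :: "'s::finite \<Rightarrow> 'a::real_normed_field"
  assumes "\<And>i. norm (w i) \<le> \<rho>"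
  shows "norm (\<Prod>i\<in>UNIV. w i ^ n i) \<le> \<rho> ^ (\<Sum>i\<in>UNIV. n i)"
proof -
  have "norm (\<Prod>i\<in>UNIV. w i ^ n i) = (\<Prod>i\<in>UNIV. norm (w i) ^ n i)"
    by (simp add: prod_norm[symmetric] norm_power)
  also have "\<dots> \<le> (\<Prod>i\<in>UNIV. \<rho> ^ n i)"
    by (intro prod_mono conjI power_mono assms) auto
  finally show ?thesis by (simp add: power_sum)
qed

text \<open>The l1 norm dominates the Euclidean norm. The added 1 in the denominator makes the bound
  strict, as the ball is open.\<close>

lemma cube_in_ball:
  fixes x y :: "real^'s"
  assumes "r > 0" "\<And>i. \<bar>y$i - x$i\<bar> \<le> r / (CARD('s) + 1)"
  shows "y \<in> ball x r"
proof -
  have "norm (y - x) \<le> (\<Sum>i\<in>UNIV. \<bar>(y - x) $ i\<bar>)" by (rule norm_le_l1_cart)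
  also have "\<dots> \<le> (\<Sum>i\<in>(UNIV::'s set). r / (CARD('s) + 1))" using assms by (intro sum_mono) auto
  also have "\<dots> < r" using assms by (simp add: field_simps)
  finally show ?thesis by (simp add: dist_norm norm_minus_commute)
qed

text \<open>Enumerating the multi-indices turns the unordered sum into a series. Unordered
  convergence of real sums is absolute, and one point of the cube controls all others.\<close>

lemma real_analytic_at_imp_ps_at:
  fixes f :: "real^'s \<Rightarrow> real^'m"
  assumes "real_analytic_at f x"
  shows "ps_at (\<lambda>y. f y $ m) x"
proof -
  obtain r c where r: "r > 0"
    and sum: "\<And>y. y \<in> ball x r \<Longrightarrow>
      ((\<lambda>\<alpha>. (\<Prod>i\<in>UNIV. (y$i - x$i) ^ (\<alpha> i)) *\<^sub>R c \<alpha>) has_sum f y) UNIV"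
    using assms unfolding real_analytic_at_def by blast
  define \<rho> where "\<rho> = r / (CARD('s) + 1)"
  have \<rho>: "\<rho> > 0" using r by (simp add: \<rho>_def add_pos_pos)
  have in_ball: "y \<in> ball x r" if "\<And>i. \<bar>y$i - x$i\<bar> \<le> \<rho>" for y
    using cube_in_ball[OF r] that unfolding \<rho>_def by blast
  \<comment> \<open>Constant multi-indices show that there are infinitely many, which the
    enumeration needs in order to be a bijection.\<close>
  have "inj (\<lambda>n::nat. \<lambda>_::'s. n)" by (auto intro!: injI dest: fun_cong)
  then have "infinite (UNIV :: ('s \<Rightarrow> nat) set)"
    using range_inj_infinite infinite_super[OF subset_UNIV] by blast
  then have bij: "bij_betw (from_nat_into UNIV) (UNIV::nat set) (UNIV :: ('s \<Rightarrow> nat) set)"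
    by (intro bij_betw_from_nat_into) auto
  define \<beta> where "\<beta> = from_nat_into (UNIV :: ('s \<Rightarrow> nat) set)"
  define a where "a k = c (\<beta> k) $ m" for k
  have hs: "((\<lambda>k. a k * (\<Prod>i\<in>UNIV. (y$i - x$i) ^ \<beta> k i)) has_sum (f y $ m)) UNIV"
    if "\<And>i. \<bar>y$i - x$i\<bar> \<le> \<rho>" for y
  proof -
    have "((\<lambda>\<alpha>. ((\<Prod>i\<in>UNIV. (y$i - x$i) ^ (\<alpha> i)) *\<^sub>R c \<alpha>) $ m) has_sum f y $ m) UNIV"
      by (rule has_sum_bounded_linear[OF bounded_linear_vec_nth sum[OF in_ball[OF that]]])
    from this[folded has_sum_reindex_bij_betw[OF bij]]
    show ?thesis by (simp add: a_def \<beta>_def mult.commute)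
  qed
  \<comment> \<open>At the corner of the cube every monomial takes its largest absolute value, a
    power of \<rho>.\<close>
  have "(\<lambda>k. a k * (\<Prod>i\<in>UNIV. ((x + (\<chi> i. \<rho>))$i - x$i) ^ \<beta> k i)) summable_on UNIV"
    using \<rho> by (intro has_sum_imp_summable[OF hs]) auto
  then have "(\<lambda>k. a k * \<rho> ^ (\<Sum>i\<in>UNIV. \<beta> k i)) summable_on UNIV"
    by (simp add: power_sum)
  then have "(\<lambda>k. norm (a k * \<rho> ^ (\<Sum>i\<in>UNIV. \<beta> k i))) summable_on UNIV"
    by (subst (asm) summable_on_iff_abs_summable_on_real)
  then have "summable (\<lambda>k. \<bar>a k\<bar> * \<rho> ^ (\<Sum>i\<in>UNIV. \<beta> k i))"
    using \<rho> by (intro summable_on_imp_summable) (simp add: abs_mult)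
  moreover have "f y $ m = (\<Sum>k. a k * (\<Prod>i\<in>UNIV. (y$i - x$i) ^ \<beta> k i))"
    if "\<And>i. \<bar>y$i - x$i\<bar> \<le> \<rho>" for y
    using has_sum_imp_sums[OF hs[OF that]] by (simp add: sums_iff)
  ultimately show ?thesis unfolding ps_at_def using \<rho> by blast
qed

text \<open>Each partial derivative is kept as a multiple of a full monomial, ready to be a term of
  a new series. When \<open>n j = 0\<close> the truncated \<open>n j - 1\<close> is harmless, since
  the factor \<open>real (n j)\<close> vanishes.\<close>

lemma has_derivative_monomial:
  fixes x y :: "real^'s"
  shows "((\<lambda>y. \<Prod>i\<in>UNIV. (y$i - x$i) ^ n i) has_derivative
    (\<lambda>v. \<Sum>j\<in>UNIV. (real (n j) * (\<Prod>i\<in>UNIV. (y$i - x$i) ^ (n(j := n j - 1)) i)) * v$j)) (at y within S)"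
proof -
  have "((\<lambda>y. \<Prod>i\<in>UNIV. (y$i - x$i) ^ n i) has_derivative
    (\<lambda>v. \<Sum>j\<in>UNIV. (real (n j) * (v$j) * (y$j - x$j) ^ (n j - 1)) *
       (\<Prod>i\<in>UNIV - {j}. (y$i - x$i) ^ n i))) (at y within S)"
    by (rule has_derivative_eq_rhs, rule has_derivative_prod, rule has_derivative_power)
       (auto intro!: derivative_eq_intros bounded_linear.has_derivative[OF bounded_linear_vec_nth])
  also have "(\<lambda>v. \<Sum>j\<in>UNIV. (real (n j) * (v$j) * (y$j - x$j) ^ (n j - 1)) *
       (\<Prod>i\<in>UNIV - {j}. (y$i - x$i) ^ n i)) =
    (\<lambda>v. \<Sum>j\<in>UNIV. (real (n j) * (\<Prod>i\<in>UNIV. (y$i - x$i) ^ (n(j := n j - 1)) i)) * v$j)"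
  proof (intro ext sum.cong refl)
    fix v :: "real^'s" and j :: 's
    have "(\<Prod>i\<in>UNIV. (y$i - x$i) ^ (n(j := n j - 1)) i) =
        (y$j - x$j) ^ (n j - 1) * (\<Prod>i\<in>UNIV - {j}. (y$i - x$i) ^ n i)"
      by (subst prod.remove[of UNIV j]) (auto intro!: prod.cong)
    then show "(real (n j) * (v$j) * (y$j - x$j) ^ (n j - 1)) * (\<Prod>i\<in>UNIV - {j}. (y$i - x$i) ^ n i) =
        (real (n j) * (\<Prod>i\<in>UNIV. (y$i - x$i) ^ (n(j := n j - 1)) i)) * v$j"
      by (simp only: mult_ac)
  qed
  finally show ?thesis .
qed

text \<open>Halving the radius absorbs the factor from differentiation: if \<open>N\<close> is the
  degree of the derivative, then \<open>n j\<close> is at most \<open>Suc N\<close>, hence at most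
  \<open>2 ^ Suc N\<close>.\<close>

lemma derivative_coefficient_le:
  fixes n :: "'s::finite \<Rightarrow> nat"
  assumes "\<rho> > 0"
  shows "real (n j) * (\<rho>/2) ^ (\<Sum>i\<in>UNIV. (n(j := n j - 1)) i) \<le> (2/\<rho>) * \<rho> ^ (\<Sum>i\<in>UNIV. n i)"
proof (cases "n j")
  case 0
  then show ?thesis using assms by simp
next
  case (Suc k)
  define N where "N = (\<Sum>i\<in>UNIV. (n(j := n j - 1)) i)"
  have "N = k + (\<Sum>i\<in>UNIV - {j}. n i)"
    unfolding N_def by (subst sum.remove[of UNIV j]) (auto simp: Suc intro!: sum.cong)
  moreover have "(\<Sum>i\<in>UNIV. n i) = Suc k + (\<Sum>i\<in>UNIV - {j}. n i)"
    by (simp add: sum.remove[of UNIV j] Suc)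
  ultimately have N: "(\<Sum>i\<in>UNIV. n i) = Suc N" "n j \<le> Suc N" using Suc by auto
  have "real (n j) \<le> real (Suc N)" using N by simp
  also have "\<dots> \<le> 2 ^ Suc N" using of_nat_less_two_power[of "Suc N", where 'a=real] by linarith
  finally have "real (n j) * (\<rho>/2) ^ N \<le> 2 ^ Suc N * (\<rho>/2) ^ N"
    using assms by (intro mult_right_mono) auto
  also have "\<dots> = (2/\<rho>) * \<rho> ^ Suc N" using assms by (simp add: power_divide)
  finally show ?thesis unfolding N(1) N_def .
qed

text \<open>The termwise derivatives converge uniformly on the ball of half the radius by the
  M-test, so differentiation and summation commute. The partials \<open>P j\<close> are again power
  series, so derivatives stay in the class.\<close>

lemma ps_at_has_derivative:
  fixes \<phi> :: "real^'s \<Rightarrow> real"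
  assumes "ps_at \<phi> x"
  obtains r P where "r > 0" "\<And>j. ps_at (P j) x"
    "\<And>y. y \<in> ball x r \<Longrightarrow> (\<phi> has_derivative (\<lambda>v. \<Sum>j\<in>UNIV. P j y * v$j)) (at y)"
proof -
  obtain \<rho> a \<beta> where \<rho>: "\<rho> > 0" and summ: "summable (\<lambda>k. \<bar>a k\<bar> * \<rho> ^ (\<Sum>i\<in>UNIV. \<beta> k i))"
    and \<phi>: "\<And>y. (\<And>i. \<bar>y$i - x$i\<bar> \<le> \<rho>) \<Longrightarrow> \<phi> y = (\<Sum>k. a k * (\<Prod>i\<in>UNIV. (y$i - x$i) ^ \<beta> k i))"
    using assms unfolding ps_at_def by blast
  define S where "S = ball x (\<rho>/2)"
  have S: "\<bar>y$i - x$i\<bar> \<le> \<rho>/2" if "y \<in> S" for y i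
  proof -
    have "\<bar>(y - x)$i\<bar> \<le> norm (y - x)" by (rule component_le_norm_cart)
    then show ?thesis using that by (simp add: S_def dist_norm norm_minus_commute)
  qed
  define b where "b j k = a k * real (\<beta> k j)" for j k
  define \<beta>' where "\<beta>' j k = (\<beta> k)(j := \<beta> k j - 1)" for j k
  define P where "P j y = (\<Sum>k. b j k * (\<Prod>i\<in>UNIV. (y$i - x$i) ^ \<beta>' j k i))" for j y
  have summ': "summable (\<lambda>k. \<bar>b j k\<bar> * (\<rho>/2) ^ (\<Sum>i\<in>UNIV. \<beta>' j k i))" for j
  proof (rule summable_comparison_test')
    show "summable (\<lambda>k. (2/\<rho>) * (\<bar>a k\<bar> * \<rho> ^ (\<Sum>i\<in>UNIV. \<beta> k i)))"
      using summ by (rule summable_mult)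
    show "norm (\<bar>b j k\<bar> * (\<rho>/2) ^ (\<Sum>i\<in>UNIV. \<beta>' j k i)) \<le>
        (2/\<rho>) * (\<bar>a k\<bar> * \<rho> ^ (\<Sum>i\<in>UNIV. \<beta> k i))" if "k \<ge> 0" for k
      using mult_left_mono[OF derivative_coefficient_le[OF \<rho>, of "\<beta> k" j], of "\<bar>a k\<bar>"] \<rho>
      by (simp add: b_def \<beta>'_def abs_mult mult_ac)
  qed
  have ps: "ps_at (P j) x" for j
    unfolding ps_at_def using summ'[of j] \<rho> by (intro exI[of _ "\<rho>/2"]) (auto simp: P_def)
  have unif: "uniform_limit S (\<lambda>n y. \<Sum>k<n. b j k * (\<Prod>i\<in>UNIV. (y$i - x$i) ^ \<beta>' j k i)) (P j) sequentially" for j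
    unfolding P_def
  proof (rule Weierstrass_m_test[OF _ summ'])
    fix k y assume "y \<in> S"
    then show "norm (b j k * (\<Prod>i\<in>UNIV. (y$i - x$i) ^ \<beta>' j k i)) \<le> \<bar>b j k\<bar> * (\<rho>/2) ^ (\<Sum>i\<in>UNIV. \<beta>' j k i)"
      unfolding norm_mult real_norm_def[of "b j k"]
      using S by (intro mult_left_mono norm_monomial_le) auto
  qed
  define T where "T k y = a k * (\<Prod>i\<in>UNIV. (y$i - x$i) ^ \<beta> k i)" for k y
  define T' where "T' k y v = (\<Sum>j\<in>UNIV. b j k * (\<Prod>i\<in>UNIV. (y$i - x$i) ^ \<beta>' j k i) * v$j)" for k y and v :: "real^'s"
  have T': "(T k has_derivative T' k y) (at y within S)" for k y
    unfolding T_def T'_def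
    by (rule has_derivative_eq_rhs[OF has_derivative_mult_right[OF has_derivative_monomial]])
       (auto simp: b_def \<beta>'_def sum_distrib_left mult_ac)
  have Tsum: "(\<lambda>k. T k y) sums \<phi> y" if "y \<in> S" for y
  proof -
    have y: "\<bar>y$i - x$i\<bar> \<le> \<rho>" for i using S[OF that, of i] \<rho> by simp
    have "norm (T k y) \<le> \<bar>a k\<bar> * \<rho> ^ (\<Sum>i\<in>UNIV. \<beta> k i)" for k
      unfolding T_def norm_mult real_norm_def[of "a k"]
      by (intro mult_left_mono norm_monomial_le) (auto simp: y)
    then have "summable (\<lambda>k. T k y)" by (intro summable_comparison_test'[OF summ])
    then show ?thesis unfolding \<phi>[OF y] T_def[symmetric] by (rule summable_sums)
  qed
  have "\<exists>g. \<forall>y\<in>S. (\<lambda>n. T n y) sums (g y) \<and> (g has_derivative (\<lambda>v. \<Sum>j\<in>UNIV. P j y * v$j)) (at y within S)"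
  proof (rule has_derivative_series)
    show "convex S" by (simp add: S_def)
    show "(T k has_derivative T' k y) (at y within S)" for k y by (rule T')
    show "x \<in> S" using \<rho> by (simp add: S_def)
    then show "(\<lambda>k. T k x) sums \<phi> x" by (rule Tsum)
    fix e :: real assume e: "e > 0"
    \<comment> \<open>The error is shared equally among the partial derivatives.\<close>
    define e' where "e' = e / CARD('s)"
    have e': "e' > 0" using e by (simp add: e'_def)
    have "\<forall>\<^sub>F n in sequentially. \<forall>y\<in>S. dist (\<Sum>k<n. b j k * (\<Prod>i\<in>UNIV. (y$i - x$i) ^ \<beta>' j k i)) (P j y) < e'" for j
      using unif[of j] e' by (simp add: uniform_limit_iff)
    then have "\<forall>\<^sub>F n in sequentially. \<forall>j. \<forall>y\<in>S. dist (\<Sum>k<n. b j k * (\<Prod>i\<in>UNIV. (y$i - x$i) ^ \<beta>' j k i)) (P j y) < e'"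
      by (simp add: eventually_all_finite)
    then show "\<forall>\<^sub>F n in sequentially. \<forall>y\<in>S. \<forall>v. norm ((\<Sum>k<n. T' k y v) - (\<Sum>j\<in>UNIV. P j y * v$j)) \<le> e * norm v"
    proof (rule eventually_mono, intro ballI allI)
      fix n y v assume n: "\<forall>j. \<forall>y\<in>S. dist (\<Sum>k<n. b j k * (\<Prod>i\<in>UNIV. (y$i - x$i) ^ \<beta>' j k i)) (P j y) < e'"
        and y: "y \<in> S"
      have "(\<Sum>k<n. T' k y v) = (\<Sum>j\<in>UNIV. (\<Sum>k<n. b j k * (\<Prod>i\<in>UNIV. (y$i - x$i) ^ \<beta>' j k i)) * v$j)"
        unfolding T'_def by (subst sum.swap) (simp add: sum_distrib_right)
      then have "norm ((\<Sum>k<n. T' k y v) - (\<Sum>j\<in>UNIV. P j y * v$j)) =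
        norm (\<Sum>j\<in>UNIV. ((\<Sum>k<n. b j k * (\<Prod>i\<in>UNIV. (y$i - x$i) ^ \<beta>' j k i)) - P j y) * v$j)"
        by (simp add: sum_subtractf left_diff_distrib)
      also have "\<dots> \<le> (\<Sum>j\<in>(UNIV::'s set). e' * norm v)"
      proof (rule sum_norm_le)
        fix j
        show "norm (((\<Sum>k<n. b j k * (\<Prod>i\<in>UNIV. (y$i - x$i) ^ \<beta>' j k i)) - P j y) * v$j) \<le> e' * norm v"
          unfolding norm_mult
          using n y e' component_le_norm_cart[of v j]
          by (intro mult_mono) (auto simp: dist_norm less_imp_le)
      qed
      also have "\<dots> = e * norm v" by (simp add: e'_def)
      finally show "norm ((\<Sum>k<n. T' k y v) - (\<Sum>j\<in>UNIV. P j y * v$j)) \<le> e * norm v" .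
    qed
  qed
  then obtain g where g: "\<And>y. y \<in> S \<Longrightarrow> (\<lambda>n. T n y) sums (g y)"
    "\<And>y. y \<in> S \<Longrightarrow> (g has_derivative (\<lambda>v. \<Sum>j\<in>UNIV. P j y * v$j)) (at y within S)" by blast
  have "g y = \<phi> y" if "y \<in> S" for y using g(1)[OF that] Tsum[OF that] by (rule sums_unique2)
  then have "(\<phi> has_derivative (\<lambda>v. \<Sum>j\<in>UNIV. P j y * v$j)) (at y within S)" if "y \<in> S" for y
    using has_derivative_transform[OF that _ g(2)[OF that], of \<phi>] by auto
  then have "(\<phi> has_derivative (\<lambda>v. \<Sum>j\<in>UNIV. P j y * v$j)) (at y)" if "y \<in> S" for y
    using that by (metis S_def at_within_open open_ball)
  then show ?thesis using that[of "\<rho>/2" P] \<rho> ps by (auto simp: S_def)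
qed

text \<open>The holomorphic extensions of the components of \<gamma> are substituted into the
  series, which converges uniformly on a small disc and so has a holomorphic sum. Curves more
  general than lines are allowed for the sake of composition.\<close>

lemma ps_at_hol_ext:
  fixes \<phi> :: "real^'s \<Rightarrow> real" and \<gamma> :: "real \<Rightarrow> real^'s"
  assumes "ps_at \<phi> (\<gamma> t)" and "\<And>i. hol_ext_at (\<lambda>u. \<gamma> u $ i) t"
  shows "hol_ext_at (\<lambda>u. \<phi> (\<gamma> u)) t"
proof -
  obtain \<rho> a \<beta> where \<rho>: "\<rho> > 0" and summ: "summable (\<lambda>k. \<bar>a k\<bar> * \<rho> ^ (\<Sum>i\<in>UNIV. \<beta> k i))"
    and \<phi>: "\<And>y. (\<And>i. \<bar>y$i - \<gamma> t$i\<bar> \<le> \<rho>) \<Longrightarrow> \<phi> y = (\<Sum>k. a k * (\<Prod>i\<in>UNIV. (y$i - \<gamma> t$i) ^ \<beta> k i))"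
    using assms unfolding ps_at_def by blast
  \<comment> \<open>Discs are shrunk until each extension stays within \<rho> of its central value,
    where the series is dominated.\<close>
  have "\<exists>r>0. \<exists>F. F holomorphic_on ball (of_real t) r \<and>
      (\<forall>u. \<bar>u - t\<bar> < r \<longrightarrow> F (of_real u) = of_real (\<gamma> u $ i)) \<and>
      (\<forall>z\<in>ball (of_real t) r. norm (F z - of_real (\<gamma> t $ i)) \<le> \<rho>)" for i
  proof -
    obtain r F where F: "r > 0" "F holomorphic_on ball (of_real t) r"
      "\<And>u. \<bar>u - t\<bar> < r \<Longrightarrow> F (of_real u) = of_real (\<gamma> u $ i)"
      using assms(2)[of i] unfolding hol_ext_at_def by blast
    have "continuous_on (ball (of_real t) r) F" using F(2) holomorphic_on_imp_continuous_on by blast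
    then have "isCont F (of_real t)" using F(1) by (simp add: continuous_on_eq_continuous_at)
    then obtain d where d: "d > 0" "\<And>z. dist z (of_real t) < d \<Longrightarrow> dist (F z) (F (of_real t)) < \<rho>"
      using \<rho> unfolding continuous_at_eps_delta by blast
    have "F (of_real t) = of_real (\<gamma> t $ i)" using F by simp
    then have "\<forall>z\<in>ball (of_real t) (min r d). norm (F z - of_real (\<gamma> t $ i)) \<le> \<rho>"
      using d(2) by (auto simp: dist_norm norm_minus_commute less_imp_le)
    moreover have "F holomorphic_on ball (of_real t) (min r d)"
      using F(2) by (auto elim!: holomorphic_on_subset)
    ultimately show ?thesis using F(1,3) d(1) by (intro exI[of _ "min r d"]) auto
  qed
  then obtain R F where R: "\<And>i. R i > 0" and F: "\<And>i. F i holomorphic_on ball (of_real t) (R i)"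
    "\<And>i u. \<bar>u - t\<bar> < R i \<Longrightarrow> F i (of_real u) = of_real (\<gamma> u $ i)"
    "\<And>i z. z \<in> ball (of_real t) (R i) \<Longrightarrow> norm (F i z - of_real (\<gamma> t $ i)) \<le> \<rho>"
    by metis
  define r where "r = Min (range R)"
  have r: "r > 0" "r \<le> R i" for i using R by (auto simp: r_def)
  have ball: "ball (of_real t) r \<subseteq> (ball (of_real t) (R i) :: complex set)" for i
    using r(2)[of i] by (intro subset_ball)
  define T where "T k z = of_real (a k) * (\<Prod>i\<in>UNIV. (F i z - of_real (\<gamma> t $ i)) ^ \<beta> k i)" for k z
  have hol: "T k holomorphic_on ball (of_real t) r" for k
    unfolding T_def using F(1)[THEN holomorphic_on_subset[OF _ ball]]
    by (intro holomorphic_intros)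
  have unif: "uniform_limit (ball (of_real t) r) (\<lambda>n z. \<Sum>k<n. T k z) (\<lambda>z. \<Sum>k. T k z) sequentially"
  proof (rule Weierstrass_m_test[OF _ summ])
    fix k z assume "z \<in> ball (complex_of_real t) r"
    then have "norm (F i z - of_real (\<gamma> t $ i)) \<le> \<rho>" for i using F(3) ball by blast
    then show "norm (T k z) \<le> \<bar>a k\<bar> * \<rho> ^ (\<Sum>i\<in>UNIV. \<beta> k i)"
      unfolding T_def norm_mult norm_of_real by (intro mult_left_mono norm_monomial_le) auto
  qed
  have "(\<lambda>z. \<Sum>k. T k z) holomorphic_on ball (of_real t) r"
  proof (rule holomorphic_uniform_sequence[of _ "\<lambda>n z. \<Sum>k<n. T k z"])
    show "(\<lambda>z. \<Sum>k<n. T k z) holomorphic_on ball (of_real t) r" for n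
      using hol by (intro holomorphic_intros)
    fix z :: complex assume "z \<in> ball (of_real t) r"
    then obtain d where "d > 0" "cball z d \<subseteq> ball (of_real t) r"
      using open_contains_cball open_ball by blast
    then show "\<exists>d. 0 < d \<and> cball z d \<subseteq> ball (of_real t) r \<and>
        uniform_limit (cball z d) (\<lambda>n z. \<Sum>k<n. T k z) (\<lambda>z. \<Sum>k. T k z) sequentially"
      using uniform_limit_on_subset[OF unif] by blast
  qed simp
  moreover have "(\<Sum>k. T k (of_real u)) = of_real (\<phi> (\<gamma> u))" if u: "\<bar>u - t\<bar> < r" for u
  proof -
    have u': "\<bar>u - t\<bar> < R i" for i using u r(2)[of i] by simp
    have b: "\<bar>\<gamma> u $ i - \<gamma> t $ i\<bar> \<le> \<rho>" for i
    proof -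
      have "of_real u \<in> ball (complex_of_real t) (R i)"
        using u'[of i] by (simp add: dist_of_real dist_real_def abs_minus_commute)
      from F(3)[OF this] have "norm (complex_of_real (\<gamma> u $ i - \<gamma> t $ i)) \<le> \<rho>" using F(2)[OF u'] by simp
      then show ?thesis unfolding norm_of_real .
    qed
    have "summable (\<lambda>k. a k * (\<Prod>i\<in>UNIV. (\<gamma> u $ i - \<gamma> t $ i) ^ \<beta> k i))"
    proof (rule summable_comparison_test'[OF summ])
      show "norm (a k * (\<Prod>i\<in>UNIV. (\<gamma> u $ i - \<gamma> t $ i) ^ \<beta> k i)) \<le> \<bar>a k\<bar> * \<rho> ^ (\<Sum>i\<in>UNIV. \<beta> k i)" for k
        unfolding norm_mult real_norm_def[of "a k"] using b by (intro mult_left_mono norm_monomial_le) auto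
    qed
    then have "complex_of_real (\<phi> (\<gamma> u)) = (\<Sum>k. of_real (a k * (\<Prod>i\<in>UNIV. (\<gamma> u $ i - \<gamma> t $ i) ^ \<beta> k i)))"
      unfolding \<phi>[OF b] by (rule suminf_of_real)
    then show ?thesis by (simp add: T_def F(2)[OF u'])
  qed
  ultimately show ?thesis unfolding hol_ext_at_def using r(1) by blast
qed

text \<open>Shrinking the cube preserves absolute convergence, so the notion is local. This matters
  for Jacobian entries, which are identified with power series only near a point.\<close>

lemma ps_at_cong:
  fixes \<phi> \<psi> :: "real^'s \<Rightarrow> real"
  assumes "ps_at \<phi> x" "r > 0" "\<And>y. y \<in> ball x r \<Longrightarrow> \<phi> y = \<psi> y"
  shows "ps_at \<psi> x"
proof -
  obtain \<rho> a \<beta> where \<rho>: "\<rho> > 0" and summ: "summable (\<lambda>k. \<bar>a k\<bar> * \<rho> ^ (\<Sum>i\<in>UNIV. \<beta> k i))"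
    and \<phi>: "\<And>y. (\<And>i. \<bar>y$i - x$i\<bar> \<le> \<rho>) \<Longrightarrow> \<phi> y = (\<Sum>k. a k * (\<Prod>i\<in>UNIV. (y$i - x$i) ^ \<beta> k i))"
    using assms(1) unfolding ps_at_def by blast
  define \<delta> where "\<delta> = min \<rho> (r / (CARD('s) + 1))"
  have \<delta>: "\<delta> > 0" "\<delta> \<le> \<rho>" "\<delta> \<le> r / (CARD('s) + 1)" using \<rho> assms(2) by (auto simp: \<delta>_def add_pos_pos)
  have "summable (\<lambda>k. \<bar>a k\<bar> * \<delta> ^ (\<Sum>i\<in>UNIV. \<beta> k i))"
    using \<delta> by (intro summable_comparison_test'[OF summ]) (auto simp: abs_mult intro!: mult_left_mono power_mono)
  moreover have "\<psi> y = (\<Sum>k. a k * (\<Prod>i\<in>UNIV. (y$i - x$i) ^ \<beta> k i))" if y: "\<forall>i. \<bar>y$i - x$i\<bar> \<le> \<delta>" for y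
  proof -
    have "y \<in> ball x r" using y \<delta>(3) assms(2) by (intro cube_in_ball) (auto intro: order_trans)
    then have "\<psi> y = \<phi> y" using assms(3) by simp
    also have "\<dots> = (\<Sum>k. a k * (\<Prod>i\<in>UNIV. (y$i - x$i) ^ \<beta> k i))"
      using y \<delta>(2) by (intro \<phi>) (auto intro: order_trans)
    finally show ?thesis .
  qed
  ultimately show ?thesis unfolding ps_at_def using \<delta>(1) by blast
qed

lemma real_analytic_has_derivative:
  fixes f :: "real^'s \<Rightarrow> real^'m"
  assumes "real_analytic f"
  shows "(f has_derivative (\<lambda>v. jacobian f (at x) *v v)) (at x)"
    and "ps_at (\<lambda>y. jacobian f (at y) $ i $ j) x"
proof -
  define Q where "Q i r P \<longleftrightarrow> r > 0 \<and> (\<forall>j. ps_at (P j) x) \<and>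
      (\<forall>y\<in>ball x r. ((\<lambda>y. f y $ i) has_derivative (\<lambda>v. \<Sum>j\<in>UNIV. P j y * v$j)) (at y))" for i r P
  have "\<exists>r P. Q i r P" for i
  proof -
    have "ps_at (\<lambda>y. f y $ i) x"
      using assms by (intro real_analytic_at_imp_ps_at) (auto simp: real_analytic_def)
    then obtain r P where "r > 0" "\<And>j. ps_at (P j) x" "\<And>y. y \<in> ball x r \<Longrightarrow>
        ((\<lambda>y. f y $ i) has_derivative (\<lambda>v. \<Sum>j\<in>UNIV. P j y * v$j)) (at y)"
      by (rule ps_at_has_derivative) blast
    then show ?thesis unfolding Q_def by blast
  qed
  then obtain R P where "\<And>i. Q i (R i) (P i)" by metis
  then have R: "\<And>i. R i > 0" and P: "\<And>i j. ps_at (P i j) x"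
    and der: "\<And>i y. y \<in> ball x (R i) \<Longrightarrow>
      ((\<lambda>y. f y $ i) has_derivative (\<lambda>v. \<Sum>j\<in>UNIV. P i j y * v$j)) (at y)"
    unfolding Q_def by blast+
  define r where "r = Min (range R)"
  have r: "r > 0" "r \<le> R i" for i using R by (auto simp: r_def)
  have D: "(f has_derivative (\<lambda>v. (\<chi> i j. P i j y) *v v)) (at y)" if "y \<in> ball x r" for y
  proof (subst has_derivative_componentwise_within, intro ballI)
    fix b :: "real^'m" assume "b \<in> Basis"
    then obtain i where b: "b = axis i 1" by (auto simp: Basis_vec_def)
    have "y \<in> ball x (R i)" using that r(2)[of i] by auto
    from der[OF this] show "((\<lambda>y. f y \<bullet> b) has_derivative (\<lambda>v. ((\<chi> i j. P i j y) *v v) \<bullet> b)) (at y)"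
      by (simp add: b inner_axis matrix_vector_mult_def)
  qed
  \<comment> \<open>The identity is needed on a whole ball, not just at \<open>x\<close>, to
    transfer the power series of the partials to the Jacobian.\<close>
  have J: "jacobian f (at y) = (\<chi> i j. P i j y)" if "y \<in> ball x r" for y
    unfolding jacobian_def frechet_derivative_at[OF D[OF that], symmetric] by simp
  show "(f has_derivative (\<lambda>v. jacobian f (at x) *v v)) (at x)"
    using D[of x] J[of x] r(1) by simp
  show "ps_at (\<lambda>y. jacobian f (at y) $ i $ j) x"
    by (rule ps_at_cong[OF P[of i j] r(1)]) (simp add: J)
qed

lemma ps_at_imp_isCont:
  assumes "ps_at \<phi> x"
  shows "isCont \<phi> x"
proof -
  obtain r P where "r > 0" "\<And>y. y \<in> ball x r \<Longrightarrow> (\<phi> has_derivative (\<lambda>v. \<Sum>j\<in>UNIV. P j y * v$j)) (at y)"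
    using ps_at_has_derivative[OF assms] by metis
  then have "(\<phi> has_derivative (\<lambda>v. \<Sum>j\<in>UNIV. P j x * v$j)) (at x)" by simp
  then show ?thesis by (rule has_derivative_continuous)
qed

text \<open>Along a line, \<open>H\<close> is a curve whose components extend holomorphically. This
  handles derivatives of \<open>f\<close> evaluated along \<open>h\<close> without composing
  multivariate power series.\<close>

lemma line_analytic_ps_compose:
  fixes \<phi> :: "real^'m \<Rightarrow> real" and H :: "'a::euclidean_space \<Rightarrow> real^'m"
  assumes ps: "\<And>x. ps_at \<phi> x" and H: "\<And>i. line_analytic (\<lambda>x. H x $ i)"
  shows "line_analytic (\<lambda>x. \<phi> (H x))"
  unfolding line_analytic_def
proof (intro conjI allI)
  have "continuous_on UNIV H"
    unfolding continuous_on_componentwise[of UNIV H]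
    using H by (auto simp: Basis_vec_def inner_axis line_analytic_def)
  moreover have "continuous_on UNIV \<phi>"
    using ps ps_at_imp_isCont by (auto simp: continuous_on_eq_continuous_at)
  ultimately show "continuous_on UNIV (\<lambda>x. \<phi> (H x))"
    by (auto intro: continuous_on_compose2)
  show "hol_ext_at (\<lambda>u. \<phi> (H (p + u *\<^sub>R v))) t" for p v t
    using H by (intro ps_at_hol_ext[OF ps]) (auto simp: line_analytic_def)
qed

lemma line_analytic_component: "line_analytic (\<lambda>x::real^'s. x $ i)"
  unfolding line_analytic_def by (auto intro!: continuous_intros hol_ext_at_affine)

lemma line_analytic_ps: "(\<And>x. ps_at \<phi> x) \<Longrightarrow> line_analytic \<phi>"
  using line_analytic_ps_compose[of \<phi> "\<lambda>x. x", OF _ line_analytic_component] by simp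

section \<open>Injectivity on sets of positive measure\<close>

text \<open>Entrywise continuity is turned into continuity in operator norm, the form required by
  the inverse function theorem.\<close>

lemma continuous_Blinfun_matrix:
  fixes M :: "real^'s \<Rightarrow> real^'k^'m"
  assumes "\<And>i j. continuous_on S (\<lambda>x. M x $ i $ j)"
  shows "continuous_on S (\<lambda>x. Blinfun (\<lambda>v. M x *v v))"
proof (rule continuous_on_blinfun_componentwise)
  fix b :: "real^'k" assume "b \<in> Basis"
  have "continuous_on S (\<lambda>x. M x *v b)"
    unfolding matrix_vector_mult_def using assms
    by (intro continuous_on_vec_lambda continuous_on_sum continuous_on_mult continuous_on_const)
  then show "continuous_on S (\<lambda>x. blinfun_apply (Blinfun (\<lambda>v. M x *v v)) b)"
    by (simp add: bounded_linear_Blinfun_apply matrix_vector_mul_bounded_linear)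
qed

text \<open>A left inverse of the derivative at \<open>p\<close> is enough, so the target may have
  larger dimension than the source.\<close>

lemma locally_injective_left_invertible_jacobian:
  fixes h :: "real^'s \<Rightarrow> real^'m" and D :: "real^'s \<Rightarrow> real^'s^'m"
  assumes der: "\<And>x. (h has_derivative (\<lambda>v. D x *v v)) (at x)"
    and cont: "\<And>i j. continuous_on UNIV (\<lambda>x. D x $ i $ j)"
    and inv: "B ** D p = mat 1"
  obtains r where "r > 0" "inj_on h (ball p r)"
proof (rule has_derivative_locally_injective[of p UNIV "\<lambda>v. B *v v" "\<lambda>x v. D x *v v" h])
  show "(*v) B \<circ> (*v) (D p) = id"
    using inv by (auto simp: fun_eq_iff matrix_vector_mul_assoc)
  define F where "F x = Blinfun (\<lambda>v. D x *v v)" for x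
  have F: "blinfun_apply (F x) = (\<lambda>v. D x *v v)" for x
    by (simp add: F_def bounded_linear_Blinfun_apply matrix_vector_mul_bounded_linear)
  have "continuous_on UNIV F" unfolding F_def by (rule continuous_Blinfun_matrix[OF cont])
  then have "isCont F p" by (simp add: continuous_on_eq_continuous_at)
  moreover have "onorm (\<lambda>v. D x *v v - D p *v v) = dist (F x) (F p)" for x
    unfolding dist_norm norm_blinfun.rep_eq by (rule arg_cong[of _ _ onorm]) (simp add: fun_eq_iff blinfun.diff_left F)
  ultimately show "\<exists>d>0. \<forall>x. dist p x < d \<longrightarrow> onorm (\<lambda>v. D x *v v - D p *v v) < e" if "e > 0" for e
    using that unfolding continuous_at_eps_delta by (simp add: dist_commute)
qed (auto intro: der that matrix_vector_mul_bounded_linear)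

text \<open>Off the null set \<open>N\<close>, a local change of coordinates makes \<open>g\<close>
  constant along one axis, which limits the sets on which \<open>g\<close> can be injective.
  \<open>U\<close> is fixed before \<open>A\<close>, so \<open>A\<close> may be cut down
  further.\<close>

lemma negligible_injective_part:
  fixes g :: "real^'s \<Rightarrow> real^'n" and D :: "real^'s \<Rightarrow> real^'s^'n"
  assumes der: "\<And>x. (g has_derivative (\<lambda>v. D x *v v)) (at x)"
    and la: "\<And>i j. line_analytic (\<lambda>x. D x $ i $ j)"
    and card: "CARD('n) < CARD('s)"
  obtains N where "negligible N"
    "\<And>p. p \<notin> N \<Longrightarrow> \<exists>U. open U \<and> p \<in> U \<and>
       (\<forall>A\<in>sets borel. inj_on g (A \<inter> U) \<longrightarrow> negligible (A \<inter> U))"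
proof -
  \<comment> \<open>The derivative of \<open>\<Phi>\<close> for \<open>J\<close>, where \<open>\<sigma> i\<close> is the component of \<open>g\<close> that replaces coordinate \<open>i\<close>.\<close>
  define M :: "'s set \<Rightarrow> ('s \<Rightarrow> 'n) \<Rightarrow> real^'s \<Rightarrow> real^'s^'s"
    where "M J \<sigma> x = (\<chi> i j. if i \<in> J then D x $ \<sigma> i $ j else if i = j then 1 else 0)" for J \<sigma> x
  have M_apply: "(M J \<sigma> x *v v) $ i = (if i \<in> J then (D x *v v) $ \<sigma> i else v $ i)" for J \<sigma> x v i
    by (simp add: M_def matrix_vector_mult_def if_distrib[of "\<lambda>c. c * _"] cong: if_cong)
  have M_la: "line_analytic (\<lambda>x. M J \<sigma> x $ i $ j)" for J \<sigma> i j
    by (cases "i \<in> J") (simp_all add: M_def la line_analytic_const)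
  define \<J> where "\<J> = {J. \<exists>\<sigma> x. det (M J \<sigma> x) \<noteq> 0}"
  have "M {} \<sigma> x = mat 1" for \<sigma> x by (simp add: M_def mat_def)
  then have "{} \<in> \<J>" by (simp add: \<J>_def)
  then obtain J where J: "J \<in> \<J>" and J_max: "\<And>J'. J' \<in> \<J> \<Longrightarrow> J \<subseteq> J' \<Longrightarrow> J = J'"
    using finite_has_maximal[of \<J>] by (metis empty_iff finite)
  then obtain \<sigma> x0 where x0: "det (M J \<sigma> x0) \<noteq> 0" by (auto simp: \<J>_def)
  \<comment> \<open>Using a component of \<open>g\<close> twice would give two equal rows. Hence
    \<open>J\<close> has at most \<open>CARD('n)\<close> elements and misses some
    \<open>i0\<close>.\<close>
  have "inj_on \<sigma> J"
  proof (rule inj_onI, rule ccontr)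
    fix i i' assume "i \<in> J" "i' \<in> J" "\<sigma> i = \<sigma> i'" "i \<noteq> i'"
    then have "det (M J \<sigma> x0) = 0"
      by (intro det_identical_rows[of i i']) (auto simp: row_def M_def)
    with x0 show False by simp
  qed
  then have "card J \<le> CARD('n)" by (metis card_image card_mono finite subset_UNIV)
  with card obtain i0 where i0: "i0 \<notin> J" by (metis UNIV_eq_I leD)
  define N where "N = {x. det (M J \<sigma> x) = 0}"
  have "negligible N"
    unfolding N_def
    by (rule line_analytic_negligible_zeros[where \<psi> = "\<lambda>x. det (M J \<sigma> x)", OF line_analytic_det x0]) (rule M_la)
  moreover
  \<comment> \<open>If \<open>D x\<close> did not kill \<open>u\<close>, row \<open>i0\<close> could
    be replaced by the derivative of a component \<open>k\<close>. A nonzero determinant at this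
    single \<open>x\<close> already contradicts maximality of \<open>J\<close>.\<close>
  have kernel: "D x *v u = 0" if u: "M J \<sigma> x *v u = axis i0 1" and x: "inj ((*v) (M J \<sigma> x))" for x u
  proof (rule ccontr)
    assume "D x *v u \<noteq> 0"
    then obtain k where k: "(D x *v u) $ k \<noteq> 0" by (auto simp: vec_eq_iff)
    define J' where "J' = insert i0 J"
    define \<sigma>' where "\<sigma>' = \<sigma>(i0 := k)"
    \<comment> \<open>Replacing coordinate \<open>i0\<close> by the \<open>k\<close>-th component keeps the matrix invertible.\<close>
    have "z = 0" if z: "M J' \<sigma>' x *v z = 0" for z
    proof -
      \<comment> \<open>The two matrices agree outside row \<open>i0\<close>, so \<open>z\<close> is
        a multiple of \<open>u\<close>; row \<open>i0\<close> then forces the multiple to be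
        zero.\<close>
      have "(M J \<sigma> x *v z) $ i = 0" if "i \<noteq> i0" for i
        using arg_cong[OF z, of "\<lambda>w. w $ i"] that by (simp add: M_apply J'_def \<sigma>'_def split: if_splits)
      moreover have "(M J \<sigma> x *v z) $ i0 = z $ i0" using i0 by (simp add: M_apply)
      ultimately have "M J \<sigma> x *v z = z $ i0 *\<^sub>R axis i0 1"
        by (auto simp: vec_eq_iff axis_def)
      also have "\<dots> = M J \<sigma> x *v (z $ i0 *\<^sub>R u)" by (simp add: u matrix_vector_mult_scaleR)
      finally have zu: "z = z $ i0 *\<^sub>R u" using x by (auto dest: injD)
      have "(D x *v z) $ k = 0"
        using arg_cong[OF z, of "\<lambda>w. w $ i0"] by (simp add: M_apply J'_def \<sigma>'_def)
      moreover have "(D x *v z) $ k = z $ i0 * (D x *v u) $ k"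
        by (subst zu) (simp add: matrix_vector_mult_scaleR)
      ultimately have "z $ i0 = 0" using k by simp
      then show "z = 0" using zu by simp
    qed
    then have "\<exists>B. B ** M J' \<sigma>' x = mat 1" by (subst matrix_left_invertible_ker) auto
    then have "det (M J' \<sigma>' x) \<noteq> 0"
      by (metis invertible_det_nz invertible_left_inverse)
    then have "J = J'" by (intro J_max) (auto simp: \<J>_def J'_def)
    then show False using i0 by (auto simp: J'_def)
  qed
  have "\<exists>U. open U \<and> p \<in> U \<and> (\<forall>A\<in>sets borel. inj_on g (A \<inter> U) \<longrightarrow> negligible (A \<inter> U))"
    if p: "p \<notin> N" for p
  proof -
    define \<Phi> :: "real^'s \<Rightarrow> real^'s" where "\<Phi> x = (\<chi> i. if i \<in> J then g x $ \<sigma> i else x $ i)" for x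
    define F where "F x = Blinfun (\<lambda>v. M J \<sigma> x *v v)" for x
    have F: "blinfun_apply (F x) = (\<lambda>v. M J \<sigma> x *v v)" for x
      by (simp add: F_def bounded_linear_Blinfun_apply matrix_vector_mul_bounded_linear)
    have \<Phi>_der: "(\<Phi> has_derivative blinfun_apply (F x)) (at x)" for x
    proof (subst has_derivative_componentwise_within, intro ballI)
      fix b :: "real^'s" assume "b \<in> Basis"
      then obtain i where b: "b = axis i 1" by (auto simp: Basis_vec_def)
      have "((\<lambda>x. g x $ k) has_derivative (\<lambda>v. (D x *v v) $ k)) (at x)" for k
        by (rule bounded_linear.has_derivative[OF bounded_linear_vec_nth der])
      moreover have "((\<lambda>x. x $ k) has_derivative (\<lambda>v. v $ k)) (at x)" for k :: 's
        by (rule bounded_linear_imp_has_derivative[OF bounded_linear_vec_nth])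
      ultimately show "((\<lambda>x. \<Phi> x \<bullet> b) has_derivative (\<lambda>v. blinfun_apply (F x) v \<bullet> b)) (at x)"
        by (cases "i \<in> J") (simp_all add: b inner_axis F M_apply \<Phi>_def)
    qed
    have F_cont: "continuous_on UNIV F"
      unfolding F_def using M_la by (intro continuous_Blinfun_matrix) (simp add: line_analytic_def)
    obtain B where B: "B ** M J \<sigma> p = mat 1"
      using p unfolding N_def mem_Collect_eq by (metis invertible_det_nz invertible_left_inverse)
    have inv: "Blinfun (\<lambda>v. B *v v) o\<^sub>L F p = id_blinfun"
      by (rule blinfun_eqI)
         (simp add: F bounded_linear_Blinfun_apply matrix_vector_mul_bounded_linear matrix_vector_mul_assoc B)
    obtain U' V G G' where U': "open U'" "p \<in> U'" and V: "open V" "\<Phi> p \<in> V"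
      and hom: "homeomorphism U' V \<Phi> G"
      and G: "\<And>y. y \<in> V \<Longrightarrow> (G has_derivative (G' y)) (at y)"
      and G': "\<And>y. y \<in> V \<Longrightarrow> G' y = Hilbert_Choice.inv (blinfun_apply (F (G y)))"
      and bij: "\<And>y. y \<in> V \<Longrightarrow> bij (blinfun_apply (F (G y)))"
      by (rule inverse_function_theorem[OF open_UNIV \<Phi>_der F_cont UNIV_I inv]) blast
    have G_in: "G y \<in> U'" and \<Phi>G: "\<Phi> (G y) = y" if "y \<in> V" for y
      using hom that by (auto simp: homeomorphism_def)
    have G\<Phi>: "G (\<Phi> x) = x" if "x \<in> U'" for x using hom that by (auto simp: homeomorphism_def)
    \<comment> \<open>A ball is taken for its convexity: segments along the \<open>i0\<close> axis
      between its points stay in \<open>V\<close>.\<close>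
    obtain \<epsilon> where \<epsilon>: "\<epsilon> > 0" "ball (\<Phi> p) \<epsilon> \<subseteq> V" using V open_contains_ball by blast
    define W where "W = ball (\<Phi> p) \<epsilon>"
    have W: "W \<subseteq> V" "open W" "convex W" "\<Phi> p \<in> W" using \<epsilon> by (auto simp: W_def)
    define U where "U = U' \<inter> \<Phi> -` W"
    have "continuous_on UNIV \<Phi>"
      using \<Phi>_der has_derivative_continuous by (force simp: continuous_on_eq_continuous_at)
    then have "open U" unfolding U_def using U' W by (intro open_Int open_vimage)
    moreover have "p \<in> U" using U' W by (simp add: U_def)
    moreover have "negligible (A \<inter> U)" if A: "A \<in> sets borel" and inj: "inj_on g (A \<inter> U)" for A
    proof -
      \<comment> \<open>This is the image of \<open>A \<inter> U\<close> under \<Phi>, written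
        through \<open>G\<close> so that it is Borel by continuity of \<open>G\<close>.\<close>
      define C where "C = {y \<in> W. G y \<in> A}"
      have gG_const: "g (G y) = g (G (y + c *\<^sub>R axis i0 1))"
        if y: "y \<in> W" "y + c *\<^sub>R axis i0 1 \<in> W" for y c
      proof -
        define q where "q t = g (G (y + t *\<^sub>R (c *\<^sub>R axis i0 1)))" for t :: real
        have "\<exists>k. \<forall>t\<in>{0..1}. q t = k"
        proof (rule has_derivative_zero_constant)
          fix t :: real assume t: "t \<in> {0..1}"
          define z where "z = y + t *\<^sub>R (c *\<^sub>R axis i0 1)"
          have "z = (1 - t) *\<^sub>R y + t *\<^sub>R (y + c *\<^sub>R axis i0 1)" by (simp add: z_def algebra_simps)
          then have "z \<in> W" using convexD_alt[OF W(3) y, of t] t by simp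
          then have z: "z \<in> V" using W by blast
          have line: "((\<lambda>t. y + t *\<^sub>R (c *\<^sub>R axis i0 1)) has_derivative (\<lambda>h. h *\<^sub>R (c *\<^sub>R axis i0 1))) (at t within {0..1})"
            by (auto intro!: derivative_eq_intros)
          \<comment> \<open>\<open>G' z\<close> inverts \<open>M J \<sigma> (G z)\<close>, so its
            value on the \<open>i0\<close> axis is a vector \<open>u\<close> as in
            \<open>kernel\<close>: the derivative of \<open>g\<close> after \<open>G\<close>
            vanishes in that direction.\<close>
          have "M J \<sigma> (G z) *v (G' z (axis i0 1)) = axis i0 1"
            using bij[OF z] unfolding G'[OF z] F by (simp add: bij_is_surj surj_f_inv_f)
          moreover have "inj ((*v) (M J \<sigma> (G z)))" using bij[OF z] unfolding F by (rule bij_is_inj)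
          ultimately have zero: "D (G z) *v (G' z (axis i0 1)) = 0" by (rule kernel)
          have "linear (G' z)" using G[OF z] by (rule has_derivative_linear)
          then have "D (G z) *v (G' z (h *\<^sub>R (c *\<^sub>R axis i0 1))) = 0" for h
            by (simp add: linear_scale matrix_vector_mult_scaleR zero)
          moreover have "(q has_derivative (\<lambda>h. D (G z) *v (G' z (h *\<^sub>R (c *\<^sub>R axis i0 1))))) (at t within {0..1})"
            unfolding q_def
            using has_derivative_compose[OF has_derivative_compose[OF line, of G "G' z"] , of g "\<lambda>v. D (G z) *v v"] G[OF z] der
            unfolding z_def by blast
          ultimately show "(q has_derivative (\<lambda>h. 0)) (at t within {0..1})" by simp
        qed simp
        then have "q 0 = q 1" by auto
        then show ?thesis by (simp add: q_def)
      qed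
      have "continuous_on W G" using G W by (meson continuous_at_imp_continuous_on has_derivative_continuous subsetD)
      then have "G \<in> borel_measurable (restrict_space borel W)"
        by (rule borel_measurable_continuous_on_restrict)
      from measurable_sets[OF this A] have "G -` A \<inter> W \<in> sets (restrict_space borel W)"
        by (simp add: space_restrict_space)
      then have "G -` A \<inter> W \<in> sets borel" using W by (subst (asm) sets_restrict_space_iff) auto
      also have "G -` A \<inter> W = C" by (auto simp: C_def)
      finally have "C \<in> sets borel" .
      moreover have "countable {t. y + t *\<^sub>R axis i0 1 \<in> C}" for y
      proof -
        have "t = t'" if "y + t *\<^sub>R axis i0 1 \<in> C" "y + t' *\<^sub>R axis i0 1 \<in> C" for t t'
        proof -
          have GU: "G w \<in> A \<inter> U" if "w \<in> C" for w
            using that W G_in \<Phi>G by (auto simp: C_def U_def)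
          have "g (G (y + t *\<^sub>R axis i0 1)) = g (G (y + t' *\<^sub>R axis i0 1))"
            using gG_const[of "y + t *\<^sub>R axis i0 1" "t' - t"] that by (simp add: C_def algebra_simps)
          then have "G (y + t *\<^sub>R axis i0 1) = G (y + t' *\<^sub>R axis i0 1)"
            using inj GU that by (auto dest: inj_onD)
          then have "y + t *\<^sub>R axis i0 1 = y + t' *\<^sub>R axis i0 1"
            using \<Phi>G that W by (metis (no_types, lifting) C_def mem_Collect_eq subsetD)
          then show "t = t'" by (simp add: axis_eq_0_iff)
        qed
        \<comment> \<open>At most one \<open>t\<close> qualifies; if none does, the inclusion holds
          whatever \<open>SOME\<close> returns.\<close>
        then have "{t. y + t *\<^sub>R axis i0 1 \<in> C} \<subseteq> {SOME t. y + t *\<^sub>R axis i0 1 \<in> C}"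
          by (auto intro: someI2)
        then show ?thesis by (rule countable_subset) simp
      qed
      ultimately have "negligible C" by (rule negligible_if_countable_on_parallels)
      then have "negligible (G ` C)"
        using G W by (intro negligible_differentiable_image_negligible)
          (auto simp: C_def differentiable_on_def differentiable_def intro: has_derivative_at_withinI)
      moreover have "A \<inter> U \<subseteq> G ` C"
        using G\<Phi> by (auto simp: U_def C_def intro!: image_eqI[of _ _ "\<Phi> _"])
      ultimately show ?thesis by (rule negligible_subset)
    qed
    ultimately show ?thesis by blast
  qed
  ultimately show ?thesis using that by blast
qed

section \<open>Deduction of the dimension inequality\<close>

theorem theorem4:
  fixes A :: "(real^'s) set"
    and h :: "real^'s \<Rightarrow> real^'m"
    and f :: "real^'m \<Rightarrow> real^'n"
  assumes "A \<in> sets borel"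
    and "emeasure lborel A > 0"
    and "CARD('s) \<le> CARD('m)"
    and "real_analytic h"
    and "\<exists>v. sJac h v \<noteq> 0"
    and "real_analytic f"
    and "inj_on f (h ` A)"
  shows "CARD('n) \<ge> CARD('s)"
proof (rule ccontr)
  assume "\<not> ?thesis"
  then have card: "CARD('n) < CARD('s)" by simp
  define H where "H x = jacobian h (at x)" for x
  have h_der: "(h has_derivative (\<lambda>v. H x *v v)) (at x)" for x
    unfolding H_def by (rule real_analytic_has_derivative[OF assms(4)])
  have H_la: "line_analytic (\<lambda>x. H x $ i $ j)" for i j
    unfolding H_def by (intro line_analytic_ps real_analytic_has_derivative[OF assms(4)])
  have h_la: "line_analytic (\<lambda>x. h x $ i)" for i
    using assms(4) by (intro line_analytic_ps real_analytic_at_imp_ps_at) (simp add: real_analytic_def)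
  \<comment> \<open>The chain rule gives the derivative of the composite; its entries are
    line-analytic as polynomials in derivatives of \<open>f\<close> along \<open>h\<close> and of
    \<open>h\<close>.\<close>
  define D where "D x = jacobian f (at (h x)) ** H x" for x
  have D_la: "line_analytic (\<lambda>x. D x $ i $ j)" for i j
    unfolding D_def
    by (intro line_analytic_matrix_mult H_la
        line_analytic_ps_compose[OF real_analytic_has_derivative(2)[OF assms(6)] h_la])
  have "((\<lambda>x. f (h x)) has_derivative (\<lambda>v. D x *v v)) (at x)" for x
    using has_derivative_compose[OF h_der real_analytic_has_derivative(1)[OF assms(6)]]
    by (simp add: D_def matrix_vector_mul_assoc)
  then obtain N where N: "negligible N" "\<And>p. p \<notin> N \<Longrightarrow> \<exists>U. open U \<and> p \<in> U \<and>
       (\<forall>A\<in>sets borel. inj_on (\<lambda>x. f (h x)) (A \<inter> U) \<longrightarrow> negligible (A \<inter> U))"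
    using negligible_injective_part[OF _ D_la card] by blast
  define Z where "Z = {x. det (transpose (H x) ** H x) = 0}"
  \<comment> \<open>Since \<open>sqrt 0 = 0\<close>, a nonzero \<open>sJac\<close> forces a nonzero
    Gram determinant.\<close>
  obtain v where "det (transpose (H v) ** H v) \<noteq> 0" using assms(5) by (auto simp: sJac_def H_def)
  moreover have "line_analytic (\<lambda>x. det (transpose (H x) ** H x))"
    by (intro line_analytic_det line_analytic_matrix_mult) (simp_all add: transpose_def H_la)
  ultimately have "negligible Z" unfolding Z_def using line_analytic_negligible_zeros by blast
  have "negligible (A - (N \<union> Z))"
  \<comment> \<open>It suffices to find a null relative neighbourhood of each point.\<close>
  proof (subst locally_negligible_alt, intro ballI)
    fix p assume p: "p \<in> A - (N \<union> Z)"
    obtain U where U: "open U" "p \<in> U"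
      "\<And>A. A \<in> sets borel \<Longrightarrow> inj_on (\<lambda>x. f (h x)) (A \<inter> U) \<Longrightarrow> negligible (A \<inter> U)"
      using N(2)[of p] p by blast
    have "det (transpose (H p) ** H p) \<noteq> 0" using p by (auto simp: Z_def)
    then obtain B where "B ** (transpose (H p) ** H p) = mat 1"
      by (metis invertible_det_nz invertible_left_inverse)
    \<comment> \<open>Invertibility of the square Gram matrix yields a left inverse of the possibly
      rectangular \<open>H p\<close>.\<close>
    then have B: "(B ** transpose (H p)) ** H p = mat 1" by (simp add: matrix_mul_assoc)
    have H_cont: "continuous_on UNIV (\<lambda>x. H x $ i $ j)" for i j
      using H_la by (simp add: line_analytic_def)
    obtain r where r: "r > 0" "inj_on h (ball p r)"
      using locally_injective_left_invertible_jacobian[OF h_der H_cont B] by blast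
    \<comment> \<open>Local injectivity of \<open>h\<close> combines with injectivity of
      \<open>f\<close> on the image of \<open>A\<close>.\<close>
    have "inj_on (\<lambda>x. f (h x)) (A \<inter> ball p r)"
      using assms(7) r(2) by (auto simp: inj_on_def)
    then have "inj_on (\<lambda>x. f (h x)) ((A \<inter> ball p r) \<inter> U)" by (rule inj_on_subset) auto
    then have "negligible ((A \<inter> ball p r) \<inter> U)" using assms(1) by (intro U) auto
    then have "negligible ((A - (N \<union> Z)) \<inter> (ball p r \<inter> U))" by (rule negligible_subset) auto
    then show "\<exists>V. openin (top_of_set (A - (N \<union> Z))) V \<and> p \<in> V \<and> negligible V"
      using p r U by (intro exI[of _ "(A - (N \<union> Z)) \<inter> (ball p r \<inter> U)"]) auto
  qed
  then have "negligible ((A - (N \<union> Z)) \<union> (N \<union> Z))"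
    using N(1) \<open>negligible Z\<close> by (intro negligible_Un)
  then have "negligible A" by (rule negligible_subset) auto
  then have "A \<in> null_sets lborel"
    using assms(1) by (simp add: negligible_iff_null_sets null_sets_completion_iff)
  with assms(2) show False by (auto simp: null_sets_def)
qed

end
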